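(* Let $\mathcal V=\ker d_0^*\subset C^1(K)$ be the divergence-free edge-cochain space of a finite oriented two-dimensional cell complex $K$, let $P:C^1(K)\to\mathcal V$ be the orthogonal projector, let $\Delta_1=d_0d_0^*+d_1^*d_1$, let $\nu,\eta>0$, let $f,g\in C^1(K)$ be time-independent, and let $B:\mathcal V\times\mathcal V\to\mathcal V$ be a continuous bilinear map with $\langle B(a,b),c\rangle=-\langle B(a,c),b\rangle$ for all $a,b,c\in\mathcal V$. Let $S(t)$, $t\ge0$, be the semiflow on $\mathcal V\times\mathcal V$ generated by $$\dot u=-\nu\Delta_1u+B(u,u)-B(h,h)+Pf,\qquad \dot h=-\eta\Delta_1h+B(u,h)-B(h,u)+Pg.$$ Assume $\mathcal H^1=\ker d_1\cap\ker d_0^*=\{0\}$, let $\lambda_*>0$ be a constant with $\langle\Delta_1v,v\rangle\ge\lambda_*\|v\|^2$ for all $v\in\mathcal V$, and put $\beta=\min(\nu,\eta)\lambda_*$ and $F=(\|Pf\|^2+\|Pg\|^2)^{1/2}$. Then for every $R>F/\beta$, the ball $$\mathcal B_R:=\{(u,h)\in\mathcal V\times\mathcal V:\ \|u\|^2+\|h\|^2\leq R^2\}$$ is positively invariant and absorbing, and the semiflow has the compact global attractor $$\mathcal A=\omega(\mathcal B_R):=\bigcap_{\tau\geq0}\overline{\bigcup_{t\geq\tau}S(t)\mathcal B_R}.$$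
   Context: $K$ is a finite oriented two-dimensional cell complex. The finite-dimensional real cochain spaces $C^q(K)$, $q=0,1,2$, carry fixed Euclidean inner products $\langle\cdot,\cdot\rangle$ with norms $\|\cdot\|$. The coboundary operators $d_0:C^0(K)\to C^1(K)$ and $d_1:C^1(K)\to C^2(K)$ are linear with $d_1d_0=0$; stars denote adjoints. The space $\mathcal V$ is invariant under $\Delta_1$. The system has a unique solution on $[0,\infty)$ for each initial datum, and $S(t)$ maps the initial datum to the solution at time $t$; it is a continuous semiflow. When $\mathcal H^1=\{0\}$ a constant $\lambda_*$ as in the claim exists (the smallest eigenvalue of $\Delta_1|_{\mathcal V}$). A set is positively invariant if $S(t)$ maps it into itself for all $t\ge0$; it is absorbing if for every bounded set $D\subset\mathcal V\times\mathcal V$ there is $t_D\ge0$ with $S(t)D$ contained in it for all $t\ge t_D$. A compact global attractor is a nonempty compact set $\mathcal A$ with $S(t)\mathcal A=\mathcal A$ for all $t\ge0$ that attracts every bounded set $D$, i.e. $\sup_{x\in D}\operatorname{dist}(S(t)x,\mathcal A)\to0$ as $t\to\infty$. *)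

theory Defs
  imports "HOL-Analysis.Analysis"
begin

section \<open>Finite oriented two-dimensional cell complexes\<close>

text \<open>
  The combinatorial data of a cell complex that enter its cochain complex: oriented edges with
  their end points, and the incidence numbers of oriented faces with oriented edges
  (\<open>face_inc K f e\<close> is the degree with which the boundary of \<open>f\<close> runs over \<open>e\<close>).
\<close>

record ('v, 'e, 'f) complex2 =
  vertices :: "'v set"
  edges :: "'e set"
  faces :: "'f set"
  tail :: "'e \<Rightarrow> 'v"
  head :: "'e \<Rightarrow> 'v"
  face_inc :: "'f \<Rightarrow> 'e \<Rightarrow> int"

text \<open>The incidence number is \<open>0\<close> when \<open>e\<close> is a loop at \<open>v\<close>.\<close>

definition edge_inc :: "('v, 'e, 'f) complex2 \<Rightarrow> 'e \<Rightarrow> 'v \<Rightarrow> int" where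
  "edge_inc K e v = of_bool (head K e = v) - of_bool (tail K e = v)"

definition finite_cell_complex :: "('v, 'e, 'f) complex2 \<Rightarrow> bool" where
  "finite_cell_complex K \<longleftrightarrow>
     finite (vertices K) \<and> finite (edges K) \<and> finite (faces K) \<and>
     tail K ` edges K \<subseteq> vertices K \<and> head K ` edges K \<subseteq> vertices K \<and>
     (\<forall>f\<in>faces K. \<forall>v\<in>vertices K. (\<Sum>e\<in>edges K. face_inc K f e * edge_inc K e v) = 0)"


section \<open>Cochains and coboundary operators\<close>

text \<open>
  The space of real cochains on a set \<open>X\<close> of cells with a fixed, arbitrary Euclidean inner product
  is a type \<open>'c\<close> of class \<^class>\<open>real_inner\<close> together with the evaluation \<open>ev c x\<close> of a cochain
  \<open>c\<close> on a cell \<open>x\<close>, which identifies \<open>'c\<close> linearly with the real functions on \<open>X\<close> (extended by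
  \<open>0\<close> outside \<open>X\<close>). The inner product is that of \<open>'c\<close>; no relation to the evaluation is imposed.
  The class \<^class>\<open>euclidean_space\<close> would exclude the zero space, that is, \<open>X = {}\<close>.
\<close>

definition cochain_space :: "'x set \<Rightarrow> ('c::real_inner \<Rightarrow> 'x \<Rightarrow> real) \<Rightarrow> bool" where
  "cochain_space X ev \<longleftrightarrow>
     (\<forall>x. linear (\<lambda>c. ev c x)) \<and> bij_betw ev UNIV {\<phi>. \<forall>x. x \<notin> X \<longrightarrow> \<phi> x = 0}"

definition coboundary0 ::
  "('v, 'e, 'f) complex2 \<Rightarrow> ('c0 \<Rightarrow> 'v \<Rightarrow> real) \<Rightarrow> ('c1 \<Rightarrow> 'e \<Rightarrow> real) \<Rightarrow> 'c0 \<Rightarrow> 'c1" where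
  "coboundary0 K ev0 ev1 a =
     (THE b. \<forall>e\<in>edges K. ev1 b e = (\<Sum>v\<in>vertices K. of_int (edge_inc K e v) * ev0 a v))"

definition coboundary1 ::
  "('v, 'e, 'f) complex2 \<Rightarrow> ('c1 \<Rightarrow> 'e \<Rightarrow> real) \<Rightarrow> ('c2 \<Rightarrow> 'f \<Rightarrow> real) \<Rightarrow> 'c1 \<Rightarrow> 'c2" where
  "coboundary1 K ev1 ev2 b =
     (THE c. \<forall>f\<in>faces K. ev2 c f = (\<Sum>e\<in>edges K. of_int (face_inc K f e) * ev1 b e))"

lemma cochain_ex1:
  assumes "cochain_space X ev"
  shows "\<exists>!c. \<forall>x\<in>X. ev c x = \<phi> x"
proof -
  let ?\<phi> = "\<lambda>x. if x \<in> X then \<phi> x else 0"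
  have "inj ev" and r: "range ev = {\<phi>. \<forall>x. x \<notin> X \<longrightarrow> \<phi> x = 0}"
    using assms by (auto simp: cochain_space_def bij_betw_def)
  have "?\<phi> \<in> range ev" unfolding r by simp
  then obtain c where c: "ev c = ?\<phi>" by (metis imageE)
  have "d = c" if "\<forall>x\<in>X. ev d x = \<phi> x" for d
  proof -
    have "ev d \<in> {\<phi>. \<forall>x. x \<notin> X \<longrightarrow> \<phi> x = 0}" using r by blast
    then have "ev d = ev c" using that c by (intro ext) auto
    then show ?thesis using \<open>inj ev\<close> by (simp add: inj_eq)
  qed
  then show ?thesis using c by (intro ex1I[of _ c]) auto
qed

lemma ev_coboundary0:
  assumes "cochain_space (edges K) ev1" and "e \<in> edges K"
  shows "ev1 (coboundary0 K ev0 ev1 a) e = (\<Sum>v\<in>vertices K. of_int (edge_inc K e v) * ev0 a v)"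
  unfolding coboundary0_def
  by (rule theI'[OF cochain_ex1[OF assms(1)], THEN bspec, OF assms(2)])

lemma ev_coboundary1:
  assumes "cochain_space (faces K) ev2" and "f \<in> faces K"
  shows "ev2 (coboundary1 K ev1 ev2 b) f = (\<Sum>e\<in>edges K. of_int (face_inc K f e) * ev1 b e)"
  unfolding coboundary1_def
  by (rule theI'[OF cochain_ex1[OF assms(1)], THEN bspec, OF assms(2)])

lemma coboundary1_coboundary0:
  assumes K: "finite_cell_complex K"
    and C1: "cochain_space (edges K) ev1" and C2: "cochain_space (faces K) ev2"
  shows "coboundary1 K ev1 ev2 (coboundary0 K ev0 ev1 a) = 0"
proof -
  have "ev2 (coboundary1 K ev1 ev2 (coboundary0 K ev0 ev1 a)) f = 0" if f: "f \<in> faces K" for f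
  proof -
    have "ev2 (coboundary1 K ev1 ev2 (coboundary0 K ev0 ev1 a)) f =
        (\<Sum>e\<in>edges K. \<Sum>v\<in>vertices K. of_int (face_inc K f e * edge_inc K e v) * ev0 a v)"
      by (simp add: ev_coboundary1[OF C2 f] ev_coboundary0[OF C1] sum_distrib_left mult.assoc)
    also have "\<dots> = (\<Sum>v\<in>vertices K.
        of_int (\<Sum>e\<in>edges K. face_inc K f e * edge_inc K e v) * ev0 a v)"
      by (subst sum.swap) (simp add: sum_distrib_right)
    also have "\<dots> = 0"
      using K f by (intro sum.neutral) (auto simp: finite_cell_complex_def)
    finally show ?thesis .
  qed
  moreover have "ev2 0 f = 0" for f
    using C2 linear_0[of "\<lambda>c. ev2 c f"] by (simp add: cochain_space_def)
  ultimately show ?thesis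
    using cochain_ex1[OF C2, of "\<lambda>_. 0"] by blast
qed


section \<open>Hodge-theoretic notions in degree one\<close>

definition div_free :: "('c0::real_inner \<Rightarrow> 'c1::real_inner) \<Rightarrow> 'c1 set" where
  "div_free d0 = {v. adjoint d0 v = 0}"

definition hodge_laplacian1 ::
  "('c0::real_inner \<Rightarrow> 'c1::real_inner) \<Rightarrow> ('c1 \<Rightarrow> 'c2::real_inner) \<Rightarrow> 'c1 \<Rightarrow> 'c1" where
  "hodge_laplacian1 d0 d1 v = d0 (adjoint d0 v) + adjoint d1 (d1 v)"

definition harmonic1 ::
  "('c0::real_inner \<Rightarrow> 'c1::real_inner) \<Rightarrow> ('c1 \<Rightarrow> 'c2::real_inner) \<Rightarrow> 'c1 set" where
  "harmonic1 d0 d1 = {v. d1 v = 0} \<inter> {v. adjoint d0 v = 0}"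

definition orth_projection :: "'c::real_inner set \<Rightarrow> 'c \<Rightarrow> 'c" where
  "orth_projection V x = (THE p. p \<in> V \<and> (\<forall>v\<in>V. (x - p) \<bullet> v = 0))"

definition bilinear_on_subspace ::
  "'c::real_vector set \<Rightarrow> ('c \<Rightarrow> 'c \<Rightarrow> 'c) \<Rightarrow> bool" where
  "bilinear_on_subspace V B \<longleftrightarrow>
     (\<forall>a\<in>V. \<forall>b\<in>V. B a b \<in> V) \<and>
     (\<forall>a\<in>V. \<forall>b\<in>V. \<forall>c\<in>V. B (a + b) c = B a c + B b c \<and> B a (b + c) = B a b + B a c) \<and>
     (\<forall>a\<in>V. \<forall>b\<in>V. \<forall>r. B (r *\<^sub>R a) b = r *\<^sub>R B a b \<and> B a (r *\<^sub>R b) = r *\<^sub>R B a b)"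


section \<open>The coupled system and its semiflow\<close>

definition mhd_field ::
  "('c0::real_inner \<Rightarrow> 'c1::real_inner) \<Rightarrow> ('c1 \<Rightarrow> 'c2::real_inner) \<Rightarrow> ('c1 \<Rightarrow> 'c1 \<Rightarrow> 'c1) \<Rightarrow>
   real \<Rightarrow> real \<Rightarrow> 'c1 \<Rightarrow> 'c1 \<Rightarrow> 'c1 \<times> 'c1 \<Rightarrow> 'c1 \<times> 'c1" where
  "mhd_field d0 d1 B \<nu> \<eta> f g = (\<lambda>(u, h).
     (- \<nu> *\<^sub>R hodge_laplacian1 d0 d1 u + B u u - B h h + orth_projection (div_free d0) f,
      - \<eta> *\<^sub>R hodge_laplacian1 d0 d1 h + B u h - B h u + orth_projection (div_free d0) g))"

definition solves_on_halfline ::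
  "('p::real_normed_vector \<Rightarrow> 'p) \<Rightarrow> 'p set \<Rightarrow> (real \<Rightarrow> 'p) \<Rightarrow> bool" where
  "solves_on_halfline G X w \<longleftrightarrow>
     (\<forall>t\<ge>0. w t \<in> X \<and> (w has_vector_derivative G (w t)) (at t within {0..}))"

text \<open>
  For a field that is locally Lipschitz on \<open>X\<close>, solutions are determined by their initial value;
  hence this fixes \<open>S t z\<close> for \<open>t \<ge> 0\<close> and \<open>z \<in> X\<close>.
\<close>

definition generates_semiflow ::
  "('p::real_normed_vector \<Rightarrow> 'p) \<Rightarrow> 'p set \<Rightarrow> (real \<Rightarrow> 'p \<Rightarrow> 'p) \<Rightarrow> bool" where
  "generates_semiflow G X S \<longleftrightarrow>
     (\<forall>z\<in>X. S 0 z = z \<and> solves_on_halfline G X (\<lambda>t. S t z))"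

definition phase_ball :: "'c::real_normed_vector set \<Rightarrow> real \<Rightarrow> ('c \<times> 'c) set" where
  "phase_ball V R = {(u, h). u \<in> V \<and> h \<in> V \<and> (norm u)\<^sup>2 + (norm h)\<^sup>2 \<le> R\<^sup>2}"


section \<open>Semiflows and attractors\<close>

definition positively_invariant :: "(real \<Rightarrow> 'p \<Rightarrow> 'p) \<Rightarrow> 'p set \<Rightarrow> bool" where
  "positively_invariant S A \<longleftrightarrow> (\<forall>t\<ge>0. S t ` A \<subseteq> A)"

definition absorbing :: "(real \<Rightarrow> 'p \<Rightarrow> 'p) \<Rightarrow> 'p::metric_space set \<Rightarrow> 'p set \<Rightarrow> bool" where
  "absorbing S X A \<longleftrightarrow>
     (\<forall>D. D \<subseteq> X \<and> bounded D \<longrightarrow> (\<exists>t\<^sub>D\<ge>0. \<forall>t\<ge>t\<^sub>D. S t ` D \<subseteq> A))"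

text \<open>
  The supremum is taken in \<^typ>\<open>ennreal\<close>, where it is \<open>0\<close> for empty \<open>D\<close> and \<open>\<infinity>\<close> for unbounded
  distances; the real-valued supremum would be unspecified there.
\<close>

definition attracts :: "(real \<Rightarrow> 'p \<Rightarrow> 'p) \<Rightarrow> 'p::metric_space set \<Rightarrow> 'p set \<Rightarrow> bool" where
  "attracts S A D \<longleftrightarrow> ((\<lambda>t. SUP x\<in>D. ennreal (infdist (S t x) A)) \<longlongrightarrow> 0) at_top"

definition compact_global_attractor ::
  "(real \<Rightarrow> 'p \<Rightarrow> 'p) \<Rightarrow> 'p::metric_space set \<Rightarrow> 'p set \<Rightarrow> bool" where
  "compact_global_attractor S X A \<longleftrightarrow>
     A \<subseteq> X \<and> A \<noteq> {} \<and> compact A \<and> (\<forall>t\<ge>0. S t ` A = A) \<and>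
     (\<forall>D. D \<subseteq> X \<and> bounded D \<longrightarrow> attracts S A D)"

definition omega_limit :: "(real \<Rightarrow> 'p \<Rightarrow> 'p) \<Rightarrow> 'p::topological_space set \<Rightarrow> 'p set" where
  "omega_limit S D = (\<Inter>\<tau>\<in>{0..}. closure (\<Union>t\<in>{\<tau>..}. S t ` D))"

end

theory Submission
  imports Defs
begin

text \<open>
  The nonlinearity does no work: antisymmetry of \<open>B\<close> makes all quadratic terms cancel when the
  equations are paired with the solution \<open>z = (u, h)\<close>. Coercivity of the Laplacian on \<open>V\<close> and the
  Cauchy-Schwarz inequality for the forcing leave, for the right-hand side \<open>G\<close>,
  \<open>G z \<bullet> z \<le> F |z| - \<beta> |z|\<^sup>2\<close> (\<open>mhd_field_dissipative\<close>). By Young's inequality and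
  Gronwall, \<open>|z(t)|\<^sup>2 - (F/\<beta>)\<^sup>2\<close> decays at least like \<open>exp (- \<beta> t)\<close>
  (\<open>dissipative_energy_decay\<close>), so every ball of radius \<open>R > F/\<beta>\<close> is positively invariant and
  absorbing.

  The same cancellation applied to the difference of two solutions gives a one-sided Lipschitz
  bound whose constant involves the size of only one of them
  (\<open>mhd_field_one_sided_lipschitz\<close>). With the energy bound, two solutions separate at most
  exponentially (\<open>one_sided_lipschitz_stability\<close>), which yields both the uniqueness behind the
  semigroup law and the continuity of every \<open>S t\<close>.

  The cochain spaces are finite-dimensional and \<open>V\<close> is closed, so the absorbing ball is compact.
  The attractor is then the intersection of the decreasing compact images \<open>S n (phase_ball V R)\<close>
  (\<open>compact_global_attractor_omega_limit\<close>).
\<close>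

section \<open>Finite-dimensional inner product spaces\<close>

text \<open>
  Gram-Schmidt, one vector at a time: the set of vectors that are reproduced by their Fourier
  expansion is a subspace, so it suffices to reproduce a spanning set.
\<close>

lemma orthonormal_expansion_exists:
  fixes A :: "'a::real_inner set"
  assumes "finite A" and "span A = UNIV"
  shows "\<exists>E. finite E \<and> (\<forall>b\<in>E. norm b = 1) \<and> (\<forall>x::'a. (\<Sum>b\<in>E. (x \<bullet> b) *\<^sub>R b) = x)"
proof -
  have "\<exists>E. finite E \<and> (\<forall>a\<in>E. \<forall>b\<in>E. a \<bullet> b = of_bool (a = b)) \<and>
      (\<forall>x\<in>A. (\<Sum>b\<in>E. (x \<bullet> b) *\<^sub>R b) = x)"
    using \<open>finite A\<close>
  proof (induction A rule: finite_induct)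
    case empty
    show ?case by (intro exI[of _ "{}"]) simp
  next
    case (insert a A)
    then obtain E where E: "finite E" "\<forall>a\<in>E. \<forall>b\<in>E. a \<bullet> b = of_bool (a = b)"
      "\<forall>x\<in>A. (\<Sum>b\<in>E. (x \<bullet> b) *\<^sub>R b) = x" by blast
    define p where "p = a - (\<Sum>b\<in>E. (a \<bullet> b) *\<^sub>R b)"
    have p_orth: "p \<bullet> b = 0" if "b \<in> E" for b
    proof -
      have "(\<Sum>c\<in>E. (a \<bullet> c) * (c \<bullet> b)) = (\<Sum>c\<in>E. if c = b then a \<bullet> b else 0)"
        using E that by (intro sum.cong) auto
      then show ?thesis
        using E(1) that by (simp add: p_def inner_diff_left inner_sum_left)
    qed
    show ?case
    proof (cases "p = 0")
      case True
      then show ?thesis using E by (intro exI[of _ E]) (auto simp: p_def)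
    next
      case False
      define e where "e = p /\<^sub>R norm p"
      have ee: "e \<bullet> e = 1"
        using False by (simp add: e_def dot_square_norm power2_eq_square field_simps)
      have eb: "e \<bullet> b = 0" "b \<bullet> e = 0" if "b \<in> E" for b
        using p_orth[OF that] by (simp_all add: e_def inner_commute)
      have "e \<notin> E" using ee eb by force
      have ae: "a = p + (\<Sum>b\<in>E. (a \<bullet> b) *\<^sub>R b)" by (simp add: p_def)
      have "a \<bullet> e = p \<bullet> e + (\<Sum>b\<in>E. (a \<bullet> b) * (b \<bullet> e))"
        by (subst ae) (simp add: inner_add_left inner_sum_left)
      then have "a \<bullet> e = norm p"
        using False eb by (simp add: e_def dot_square_norm power2_eq_square field_simps)
      then have "(a \<bullet> e) *\<^sub>R e = p" using False by (simp add: e_def)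
      moreover have "x \<bullet> e = 0" if "x \<in> A" for x
      proof -
        have "(\<Sum>b\<in>E. (x \<bullet> b) *\<^sub>R b) \<bullet> e = 0" using eb by (simp add: inner_sum_left)
        then show ?thesis using E(3) that by simp
      qed
      ultimately have "(\<Sum>b\<in>insert e E. (x \<bullet> b) *\<^sub>R b) = x" if "x \<in> insert a A" for x
        using that E \<open>e \<notin> E\<close> ae by auto
      then show ?thesis
        using E ee eb \<open>e \<notin> E\<close> by (intro exI[of _ "insert e E"]) auto
    qed
  qed
  then obtain E where E: "finite E" "\<forall>a\<in>E. \<forall>b\<in>E. a \<bullet> b = of_bool (a = b)"
    "\<forall>x\<in>A. (\<Sum>b\<in>E. (x \<bullet> b) *\<^sub>R b) = x" by blast
  have "subspace {x. (\<Sum>b\<in>E. (x \<bullet> b) *\<^sub>R b) = x}"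
    by (auto simp: subspace_def inner_add_left scaleR_add_left sum.distrib
        simp flip: scaleR_scaleR scaleR_sum_right)
  then have "span A \<subseteq> {x. (\<Sum>b\<in>E. (x \<bullet> b) *\<^sub>R b) = x}"
    using E(3) by (intro span_minimal) auto
  then show ?thesis
    using E(1,2) \<open>span A = UNIV\<close> by (intro exI[of _ E]) (auto simp: norm_eq_1)
qed

text \<open>
  Adding a vector to \<open>E\<close> takes the box to a continuous image of its product with an interval.
\<close>

lemma compact_coordinate_box:
  fixes E :: "'a::real_normed_vector set"
  assumes "finite E"
  shows "compact {\<Sum>b\<in>E. c b *\<^sub>R b | c. \<forall>b\<in>E. \<bar>c b\<bar> \<le> M}"
  using assms
proof (induction E rule: finite_induct)
  case empty
  show ?case by simp
next
  case (insert e E)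
  let ?K = "{\<Sum>b\<in>E. c b *\<^sub>R b | c. \<forall>b\<in>E. \<bar>c b\<bar> \<le> M}"
  have "{\<Sum>b\<in>insert e E. c b *\<^sub>R b | c. \<forall>b\<in>insert e E. \<bar>c b\<bar> \<le> M} =
      (\<lambda>(t, k). t *\<^sub>R e + k) ` ({-M..M} \<times> ?K)" (is "?L = ?R")
  proof
    show "?L \<subseteq> ?R"
    proof
      fix x assume "x \<in> ?L"
      then obtain c where c: "x = (\<Sum>b\<in>insert e E. c b *\<^sub>R b)" "\<forall>b\<in>insert e E. \<bar>c b\<bar> \<le> M"
        by blast
      have "(c e, \<Sum>b\<in>E. c b *\<^sub>R b) \<in> {-M..M} \<times> ?K" using c(2) by (auto simp: abs_le_iff)
      moreover have "x = (\<lambda>(t, k). t *\<^sub>R e + k) (c e, \<Sum>b\<in>E. c b *\<^sub>R b)"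
        using c(1) insert.hyps by simp
      ultimately show "x \<in> ?R" by blast
    qed
    show "?R \<subseteq> ?L"
    proof clarify
      fix t and c :: "'a \<Rightarrow> real"
      assume t: "t \<in> {-M..M}" and c: "\<forall>b\<in>E. \<bar>c b\<bar> \<le> M"
      have "(\<Sum>b\<in>E. (c(e := t)) b *\<^sub>R b) = (\<Sum>b\<in>E. c b *\<^sub>R b)"
        using insert.hyps by (intro sum.cong) auto
      then show "\<exists>c'. t *\<^sub>R e + (\<Sum>b\<in>E. c b *\<^sub>R b) = (\<Sum>b\<in>insert e E. c' b *\<^sub>R b) \<and>
          (\<forall>b\<in>insert e E. \<bar>c' b\<bar> \<le> M)"
        using insert.hyps t c by (intro exI[of _ "c(e := t)"]) auto
    qed
  qed
  moreover have "compact ?R"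
    by (intro compact_continuous_image compact_Times insert.IH)
      (auto intro!: continuous_intros simp: case_prod_unfold)
  ultimately show ?case by simp
qed

lemma compact_cball_finite_span:
  fixes A :: "'a::real_inner set"
  assumes "finite A" and "span A = UNIV"
  shows "compact (cball (0::'a) r)"
proof -
  obtain E where E: "finite E" "\<forall>b\<in>E. norm b = 1" "\<And>x::'a. (\<Sum>b\<in>E. (x \<bullet> b) *\<^sub>R b) = x"
    using orthonormal_expansion_exists[OF assms] by blast
  let ?K = "{\<Sum>b\<in>E. c b *\<^sub>R b | c. \<forall>b\<in>E. \<bar>c b\<bar> \<le> r}"
  have "cball 0 r \<subseteq> ?K"
  proof
    fix x :: 'a assume x: "x \<in> cball 0 r"
    have "\<bar>x \<bullet> b\<bar> \<le> r" if "b \<in> E" for b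
      using Cauchy_Schwarz_ineq2[of x b] x E(2) that by simp
    then show "x \<in> ?K" using E(3)[of x] by (auto intro!: exI[of _ "\<lambda>b. x \<bullet> b"])
  qed
  then have "?K \<inter> cball 0 r = cball 0 r" by (rule Int_absorb1)
  moreover have "compact (?K \<inter> cball 0 r)"
    by (rule compact_Int_closed[OF compact_coordinate_box[OF E(1)] closed_cball])
  ultimately show ?thesis by simp
qed

text \<open>
  The constant \<open>adjoint\<close> is a choice of adjoint map, so an adjoint has to be exhibited: expanding
  \<open>x\<close> in an orthonormal basis of the domain shows that sending \<open>y\<close> to the vector with coordinates
  \<open>d b \<bullet> y\<close> is one.
\<close>

lemma adjoint_inner_finite_span:
  fixes d :: "'a::real_inner \<Rightarrow> 'b::real_inner"
  assumes "linear d" and "finite A" and "span A = (UNIV :: 'a set)"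
  shows "d x \<bullet> y = x \<bullet> adjoint d y"
proof -
  obtain E where E: "finite E" "\<And>x::'a. (\<Sum>b\<in>E. (x \<bullet> b) *\<^sub>R b) = x"
    using orthonormal_expansion_exists[OF assms(2,3)] by blast
  have riesz: "d x \<bullet> y = x \<bullet> (\<Sum>b\<in>E. (d b \<bullet> y) *\<^sub>R b)" for x y
  proof -
    have "d x \<bullet> y = d (\<Sum>b\<in>E. (x \<bullet> b) *\<^sub>R b) \<bullet> y" by (simp only: E(2))
    also have "\<dots> = x \<bullet> (\<Sum>b\<in>E. (d b \<bullet> y) *\<^sub>R b)"
      by (simp add: linear_sum[OF assms(1)] linear_cmul[OF assms(1)] inner_sum_left
          inner_sum_right mult.commute)
    finally show ?thesis .
  qed
  have "adjoint d = (\<lambda>y. \<Sum>b\<in>E. (d b \<bullet> y) *\<^sub>R b)"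
    by (rule adjoint_unique) (intro allI riesz)
  then show ?thesis by (simp only: riesz[of x y])
qed

lemma linear_adjoint_finite_span:
  fixes d :: "'a::real_inner \<Rightarrow> 'b::real_inner"
  assumes "linear d" and "finite A" and "span A = (UNIV :: 'a set)"
  shows "linear (adjoint d)"
proof (rule linearI)
  note adj = adjoint_inner_finite_span[OF assms, symmetric]
  fix x y :: 'b and r :: real
  show "adjoint d (x + y) = adjoint d x + adjoint d y"
    by (subst vector_eq_ldot[symmetric]) (simp add: adj inner_add_right)
  show "adjoint d (r *\<^sub>R x) = r *\<^sub>R adjoint d x"
    by (subst vector_eq_ldot[symmetric]) (simp add: adj)
qed


section \<open>Cochain spaces and the divergence-free subspace\<close>

lemma cochain_eqI:
  assumes "cochain_space X ev" and "\<And>x. x \<in> X \<Longrightarrow> ev c x = ev d x"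
  shows "c = d"
  using cochain_ex1[OF assms(1), of "ev d"] assms(2) by blast

lemma cochain_space_finite_span:
  fixes ev :: "'c::real_inner \<Rightarrow> 'x \<Rightarrow> real"
  assumes C: "cochain_space X ev" and "finite X"
  shows "\<exists>A. finite A \<and> span A = (UNIV :: 'c set)"
proof -
  have lin: "linear (\<lambda>c. ev c x)" for x using C by (simp add: cochain_space_def)
  have "\<exists>c. \<forall>x\<in>X. ev c x = of_bool (x = y)" for y
    by (rule ex1_implies_ex[OF cochain_ex1[OF C]])
  then obtain e where e: "\<And>x y. x \<in> X \<Longrightarrow> ev (e y) x = of_bool (x = y)" by metis
  have "c \<in> span (e ` X)" for c
  proof -
    have "c = (\<Sum>y\<in>X. ev c y *\<^sub>R e y)"
    proof (rule cochain_eqI[OF C])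
      fix x assume "x \<in> X"
      then show "ev c x = ev (\<Sum>y\<in>X. ev c y *\<^sub>R e y) x"
        using \<open>finite X\<close> by (simp add: linear_sum[OF lin] linear_cmul[OF lin] e of_bool_def if_distrib
            cong: if_cong)
    qed
    also have "\<dots> \<in> span (e ` X)" by (intro span_sum span_scale span_base) auto
    finally show ?thesis .
  qed
  then show ?thesis using \<open>finite X\<close> by (intro exI[of _ "e ` X"]) auto
qed

lemma linear_coboundary0:
  assumes C0: "cochain_space (vertices K) ev0" and C1: "cochain_space (edges K) ev1"
  shows "linear (coboundary0 K ev0 ev1)"
proof (rule linearI)
  have l0: "linear (\<lambda>c. ev0 c x)" and l1: "linear (\<lambda>c. ev1 c y)" for x y
    using C0 C1 by (simp_all add: cochain_space_def)
  note ev = linear_add[OF l0] linear_add[OF l1] linear_cmul[OF l0] linear_cmul[OF l1]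
    ev_coboundary0[OF C1]
  fix a b and r :: real
  show "coboundary0 K ev0 ev1 (a + b) = coboundary0 K ev0 ev1 a + coboundary0 K ev0 ev1 b"
    by (rule cochain_eqI[OF C1]) (simp add: ev algebra_simps sum.distrib)
  show "coboundary0 K ev0 ev1 (r *\<^sub>R a) = r *\<^sub>R coboundary0 K ev0 ev1 a"
    by (rule cochain_eqI[OF C1]) (simp add: ev sum_distrib_left mult.left_commute)
qed

lemma linear_coboundary1:
  assumes C1: "cochain_space (edges K) ev1" and C2: "cochain_space (faces K) ev2"
  shows "linear (coboundary1 K ev1 ev2)"
proof (rule linearI)
  have l1: "linear (\<lambda>c. ev1 c x)" and l2: "linear (\<lambda>c. ev2 c y)" for x y
    using C1 C2 by (simp_all add: cochain_space_def)
  note ev = linear_add[OF l1] linear_add[OF l2] linear_cmul[OF l1] linear_cmul[OF l2]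
    ev_coboundary1[OF C2]
  fix a b and r :: real
  show "coboundary1 K ev1 ev2 (a + b) = coboundary1 K ev1 ev2 a + coboundary1 K ev1 ev2 b"
    by (rule cochain_eqI[OF C2]) (simp add: ev algebra_simps sum.distrib)
  show "coboundary1 K ev1 ev2 (r *\<^sub>R a) = r *\<^sub>R coboundary1 K ev1 ev2 a"
    by (rule cochain_eqI[OF C2]) (simp add: ev sum_distrib_left mult.left_commute)
qed

lemma linear_hodge_laplacian1:
  assumes "linear d0" "linear (adjoint d0)" "linear d1" "linear (adjoint d1)"
  shows "linear (hodge_laplacian1 d0 d1)"
  by (rule linearI) (simp_all add: hodge_laplacian1_def linear_add[OF assms(1)]
      linear_add[OF assms(2)] linear_add[OF assms(3)] linear_add[OF assms(4)]
      linear_cmul[OF assms(1)] linear_cmul[OF assms(2)] linear_cmul[OF assms(3)]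
      linear_cmul[OF assms(4)] scaleR_add_right)

text \<open>
  The kernel of the adjoint is the orthogonal complement of the range, which is closed in any
  inner product space.
\<close>

lemma closed_div_free:
  assumes adj: "\<And>x y. d0 x \<bullet> y = x \<bullet> adjoint d0 y"
  shows "closed (div_free d0)"
proof -
  have "div_free d0 = (\<Inter>x. {v. d0 x \<bullet> v = 0})"
  proof (intro set_eqI iffI)
    fix v assume "v \<in> (\<Inter>x. {v. d0 x \<bullet> v = 0})"
    then have "x \<bullet> adjoint d0 v = 0" for x by (simp flip: adj)
    from this[of "adjoint d0 v"] show "v \<in> div_free d0" by (simp add: div_free_def)
  qed (simp add: div_free_def adj)
  then show ?thesis by (auto intro!: closed_INT closed_Collect_eq continuous_intros)
qed


section \<open>Energy estimates for dissipative fields\<close>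

lemma gronwall_exponential:
  fixes y y' :: "real \<Rightarrow> real"
  assumes cont: "continuous_on {0..} y"
    and deriv: "\<And>s. s > 0 \<Longrightarrow> (y has_real_derivative y' s) (at s)"
    and le: "\<And>s. s > 0 \<Longrightarrow> y' s \<le> k * y s"
    and "t \<ge> 0"
  shows "y t \<le> exp (k * t) * y 0"
proof -
  have "y 0 * exp (- k * 0) \<ge> y t * exp (- k * t)"
  proof (rule DERIV_nonpos_imp_decreasing_open[OF \<open>t \<ge> 0\<close>])
    fix s assume "0 < s" "s < t"
    have "((\<lambda>s. y s * exp (- k * s)) has_real_derivative (y' s - k * y s) * exp (- k * s)) (at s)"
      by (rule derivative_eq_intros deriv \<open>0 < s\<close> refl)+ (simp add: algebra_simps)
    moreover have "(y' s - k * y s) * exp (- k * s) \<le> 0"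
      using le[OF \<open>0 < s\<close>] by (simp add: mult_nonpos_nonneg)
    ultimately show "\<exists>d. ((\<lambda>s. y s * exp (- k * s)) has_real_derivative d) (at s) \<and> d \<le> 0"
      by blast
  qed (intro continuous_intros continuous_on_subset[OF cont], auto)
  then show ?thesis by (simp add: exp_minus field_simps)
qed

text \<open>
  The offset \<open>e\<close> lets one estimate serve twice: with \<open>e = (F/\<beta>)\<^sup>2\<close> for the decay of a single
  solution, and with \<open>e = 0\<close> for the difference of two solutions.
\<close>

lemma energy_growth:
  fixes w w' :: "real \<Rightarrow> 'p::real_inner"
  assumes deriv: "\<And>s. s \<ge> 0 \<Longrightarrow> (w has_vector_derivative w' s) (at s within {0..})"
    and le: "\<And>s. s \<ge> 0 \<Longrightarrow> w' s \<bullet> w s \<le> k * ((norm (w s))\<^sup>2 - e)"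
    and "t \<ge> 0"
  shows "(norm (w t))\<^sup>2 - e \<le> exp (2 * k * t) * ((norm (w 0))\<^sup>2 - e)"
proof (rule gronwall_exponential[where y' = "\<lambda>s. 2 * (w' s \<bullet> w s)"])
  have "continuous_on {0..} w"
    using has_vector_derivative_continuous[OF deriv]
    by (auto simp: continuous_on_eq_continuous_within)
  then show "continuous_on {0..} (\<lambda>s. (norm (w s))\<^sup>2 - e)" by (intro continuous_intros)
next
  fix s :: real assume s: "s > 0"
  have "(w has_vector_derivative w' s) (at s)"
    using deriv[of s] s at_within_interior[of s "{0..}"] by simp
  from bounded_bilinear.has_vector_derivative[OF bounded_bilinear_inner this this]
  have "((\<lambda>s. w s \<bullet> w s) has_real_derivative 2 * (w' s \<bullet> w s)) (at s)"
    by (simp add: has_real_derivative_iff_has_vector_derivative inner_commute)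
  then show "((\<lambda>s. (norm (w s))\<^sup>2 - e) has_real_derivative 2 * (w' s \<bullet> w s)) (at s)"
    unfolding dot_square_norm by (rule DERIV_diff[OF _ DERIV_const, simplified])
  show "2 * (w' s \<bullet> w s) \<le> 2 * k * ((norm (w s))\<^sup>2 - e)" using le[of s] s by simp
qed fact

lemma dissipative_energy_decay:
  fixes G :: "'p::real_inner \<Rightarrow> 'p"
  assumes sol: "solves_on_halfline G X p"
    and diss: "\<And>z. z \<in> X \<Longrightarrow> G z \<bullet> z \<le> F * norm z - \<beta> * (norm z)\<^sup>2"
    and "\<beta> > 0" and "t \<ge> 0"
  shows "(norm (p t))\<^sup>2 - (F / \<beta>)\<^sup>2 \<le> exp (- \<beta> * t) * ((norm (p 0))\<^sup>2 - (F / \<beta>)\<^sup>2)"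
proof -
  \<comment> \<open>Young's inequality; half of the dissipation is spent on absorbing the forcing.\<close>
  have young: "F * a - \<beta> * a\<^sup>2 \<le> - (\<beta> / 2) * (a\<^sup>2 - (F / \<beta>)\<^sup>2)" for a
  proof -
    have "0 \<le> \<beta> / 2 * (a - F / \<beta>)\<^sup>2" using \<open>\<beta> > 0\<close> by simp
    also have "\<dots> = - (\<beta> / 2) * (a\<^sup>2 - (F / \<beta>)\<^sup>2) - (F * a - \<beta> * a\<^sup>2)"
      using \<open>\<beta> > 0\<close> by (simp add: power2_eq_square field_simps)
    finally show ?thesis by simp
  qed
  have "G (p s) \<bullet> p s \<le> - (\<beta> / 2) * ((norm (p s))\<^sup>2 - (F / \<beta>)\<^sup>2)" if "s \<ge> 0" for s
    using diss[of "p s"] young[of "norm (p s)"] sol that by (force simp: solves_on_halfline_def)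
  then have "(norm (p t))\<^sup>2 - (F / \<beta>)\<^sup>2 \<le>
      exp (2 * (- (\<beta> / 2)) * t) * ((norm (p 0))\<^sup>2 - (F / \<beta>)\<^sup>2)"
    using sol \<open>t \<ge> 0\<close> by (intro energy_growth[where w' = "\<lambda>s. G (p s)"])
      (auto simp: solves_on_halfline_def)
  then show ?thesis by simp
qed

lemma one_sided_lipschitz_stability:
  fixes G :: "'p::real_inner \<Rightarrow> 'p"
  assumes p: "solves_on_halfline G X p" and q: "solves_on_halfline G X q"
    and lip: "\<And>z w. z \<in> X \<Longrightarrow> w \<in> X \<Longrightarrow> (G z - G w) \<bullet> (z - w) \<le> C * norm z * (norm (z - w))\<^sup>2"
    and "C \<ge> 0" and M: "\<And>s. s \<ge> 0 \<Longrightarrow> norm (p s) \<le> M" and "t \<ge> 0"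
  shows "norm (p t - q t) \<le> exp (C * M * t) * norm (p 0 - q 0)"
proof -
  have "(norm (p t - q t))\<^sup>2 - 0 \<le> exp (2 * (C * M) * t) * ((norm (p 0 - q 0))\<^sup>2 - 0)"
  proof (rule energy_growth[where w' = "\<lambda>s. G (p s) - G (q s)"])
    fix s :: real assume s: "s \<ge> 0"
    show "((\<lambda>s. p s - q s) has_vector_derivative G (p s) - G (q s)) (at s within {0..})"
      using p q s by (auto simp: solves_on_halfline_def intro!: has_vector_derivative_diff)
    have "(G (p s) - G (q s)) \<bullet> (p s - q s) \<le> C * norm (p s) * (norm (p s - q s))\<^sup>2"
      using lip p q s by (simp add: solves_on_halfline_def)
    also have "\<dots> \<le> C * M * (norm (p s - q s))\<^sup>2"
      using M[OF s] \<open>C \<ge> 0\<close> by (intro mult_right_mono mult_left_mono) auto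
    finally show "(G (p s) - G (q s)) \<bullet> (p s - q s) \<le> C * M * ((norm (p s - q s))\<^sup>2 - 0)"
      by simp
  qed fact
  also have "\<dots> = (exp (C * M * t) * norm (p 0 - q 0))\<^sup>2"
    by (simp add: power_mult_distrib mult.assoc flip: exp_double)
  finally show ?thesis by - (rule power2_le_imp_le, simp_all)
qed


section \<open>Global attractors from compact absorbing sets\<close>

lemma compact_nested_nonempty:
  fixes F :: "nat \<Rightarrow> 'a::t2_space set"
  assumes "\<And>n. compact (F n)" and "\<And>n. F n \<noteq> {}" and dec: "decseq F"
  shows "\<exists>x. \<forall>n. x \<in> F n"
proof -
  have "F 0 \<inter> \<Inter>(range F) \<noteq> {}"
  proof (rule compact_imp_fip)
    fix \<F> assume "finite \<F>" "\<F> \<subseteq> range F"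
    then obtain N where N: "finite N" "\<F> = F ` N" by (metis finite_subset_image)
    have "F (Max (insert 0 N)) \<subseteq> F n" if "n \<in> insert 0 N" for n
      using N(1) that decseqD[OF dec] by (meson Max_ge finite_insert)
    then have "F (Max (insert 0 N)) \<subseteq> F 0 \<inter> \<Inter>\<F>" using N(2) by blast
    then show "F 0 \<inter> \<Inter>\<F> \<noteq> {}" using assms(2) by blast
  qed (use assms in \<open>auto intro: compact_imp_closed\<close>)
  then show ?thesis by blast
qed

text \<open>
  For a positively invariant set \<open>A\<close> the union of the images \<open>S t A\<close> over \<open>t \<ge> \<tau>\<close> is \<open>S \<tau> A\<close>
  itself, so the \<open>\<omega>\<close>-limit set is the intersection of a decreasing sequence of compact sets. Each
  of nonemptiness, \<open>\<omega> \<subseteq> S t \<omega>\<close> and attraction then follows by applying Cantor's intersection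
  theorem to a suitable sequence of compact subsets of \<open>S n A\<close>.
\<close>

lemma compact_global_attractor_omega_limit:
  fixes S :: "real \<Rightarrow> 'p::metric_space \<Rightarrow> 'p"
  assumes semigroup: "\<And>s t z. s \<ge> 0 \<Longrightarrow> t \<ge> 0 \<Longrightarrow> z \<in> X \<Longrightarrow> S (s + t) z = S s (S t z)"
    and start: "\<And>z. z \<in> X \<Longrightarrow> S 0 z = z"
    and cont: "\<And>t. t \<ge> 0 \<Longrightarrow> continuous_on X (S t)"
    and A: "A \<subseteq> X" "compact A" "A \<noteq> {}"
    and inv: "positively_invariant S A"
    and abs: "absorbing S X A"
  shows "compact_global_attractor S X (omega_limit S A)"
proof -
  have compact_S: "compact (S t ` A)" if "t \<ge> 0" for t
    using cont[OF that] A by (auto intro: compact_continuous_image continuous_on_subset)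
  have anti: "S t ` A \<subseteq> S s ` A" if "0 \<le> s" "s \<le> t" for s t
  proof
    fix x assume "x \<in> S t ` A"
    then obtain a where a: "a \<in> A" "x = S t a" by blast
    have "x = S s (S (t - s) a)" using semigroup[of s "t - s" a] a A that by auto
    moreover have "S (t - s) a \<in> A"
      using inv a(1) that unfolding positively_invariant_def by (meson diff_ge_0_iff_ge image_subset_iff)
    ultimately show "x \<in> S s ` A" by blast
  qed
  \<comment> \<open>Integer times suffice because the images decrease; they make Cantor's theorem applicable.\<close>
  define I where "I n = S (real n) ` A" for n
  have I_dec: "decseq I" unfolding I_def by (intro decseq_SucI anti) auto
  have I_compact: "compact (I n)" and I_ne: "I n \<noteq> {}" for n
    using compact_S A by (simp_all add: I_def)
  have I_A: "I n \<subseteq> A" for n using inv by (simp add: I_def positively_invariant_def)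
  have \<omega>: "omega_limit S A = (\<Inter>n. I n)"
  proof -
    have "(\<Union>t\<in>{\<tau>..}. S t ` A) = S \<tau> ` A" if "\<tau> \<ge> 0" for \<tau>
      using anti that by fastforce
    then have "omega_limit S A = (\<Inter>\<tau>\<in>{0..}. S \<tau> ` A)"
      using compact_S by (auto simp: omega_limit_def compact_imp_closed closure_closed)
    also have "\<dots> = (\<Inter>n. I n)"
    proof
      show "(\<Inter>\<tau>\<in>{0..}. S \<tau> ` A) \<subseteq> (\<Inter>n. I n)" by (auto simp: I_def)
      show "(\<Inter>n. I n) \<subseteq> (\<Inter>\<tau>\<in>{0..}. S \<tau> ` A)"
      proof (intro INT_greatest)
        fix \<tau> :: real assume "\<tau> \<in> {0..}"
        then have "I (nat \<lceil>\<tau>\<rceil>) \<subseteq> S \<tau> ` A"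
          unfolding I_def by (intro anti) (auto simp: real_nat_ceiling_ge)
        then show "(\<Inter>n. I n) \<subseteq> S \<tau> ` A" by blast
      qed
    qed
    finally show ?thesis .
  qed
  have \<omega>_ne: "omega_limit S A \<noteq> {}"
    using compact_nested_nonempty[OF I_compact I_ne I_dec] by (auto simp: \<omega>)
  have \<omega>_A: "omega_limit S A \<subseteq> A" using I_A by (auto simp: \<omega>)
  have \<omega>_compact: "compact (omega_limit S A)"
  proof -
    have "closed (omega_limit S A)"
      unfolding \<omega> by (intro closed_INT) (auto intro: compact_imp_closed I_compact)
    then have "compact (A \<inter> omega_limit S A)" using A(2) by (rule compact_Int_closed[rotated])
    then show ?thesis using \<omega>_A by (simp add: Int_absorb1)
  qed
  have \<omega>_inv: "S t ` omega_limit S A = omega_limit S A" if t: "t \<ge> 0" for t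
  proof
    show "S t ` omega_limit S A \<subseteq> omega_limit S A"
    proof clarify
      fix x assume x: "x \<in> omega_limit S A"
      have "S t x \<in> I n" for n
      proof -
        obtain a where a: "a \<in> A" "x = S (real n) a" using x by (auto simp: \<omega> I_def)
        then have "S t x = S (t + real n) a" using semigroup[of t "real n" a] t A by auto
        also have "\<dots> \<in> I n" using anti[of "real n" "t + real n"] a t by (auto simp: I_def)
        finally show ?thesis .
      qed
      then show "S t x \<in> omega_limit S A" by (simp add: \<omega>)
    qed
    show "omega_limit S A \<subseteq> S t ` omega_limit S A"
    proof
      fix x assume x: "x \<in> omega_limit S A"
      \<comment> \<open>The preimages of \<open>x\<close> in \<open>S n A\<close> decrease with \<open>n\<close>; none is empty, since \<open>x \<in> S (t + n) A\<close>.\<close>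
      define Y where "Y n = {y \<in> I n. S t y = x}" for n
      have "\<exists>y. \<forall>n. y \<in> Y n"
      proof (rule compact_nested_nonempty)
        fix n
        have "continuous_on (I n) (S t)"
          using cont[OF t] I_A A(1) by (meson continuous_on_subset subset_trans)
        then have "closed (I n \<inter> S t -` {x})"
          using I_compact by (intro continuous_closed_preimage) (auto intro: compact_imp_closed)
        then have "compact (I n \<inter> (I n \<inter> S t -` {x}))"
          using I_compact by (rule compact_Int_closed[rotated])
        moreover have "I n \<inter> (I n \<inter> S t -` {x}) = Y n" by (auto simp: Y_def)
        ultimately show "compact (Y n)" by simp
        have "I (nat \<lceil>t + real n\<rceil>) \<subseteq> S (t + real n) ` A"
          unfolding I_def using t by (intro anti) (auto simp: real_nat_ceiling_ge)
        then obtain a where a: "a \<in> A" "x = S (t + real n) a" using x by (auto simp: \<omega>)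
        then have "S (real n) a \<in> Y n" using semigroup[of t "real n" a] t A
          by (auto simp: Y_def I_def)
        then show "Y n \<noteq> {}" by blast
      next
        show "decseq Y" using I_dec by (auto simp: decseq_def Y_def)
      qed
      then obtain y where "\<And>n. y \<in> Y n" by blast
      then have "y \<in> omega_limit S A" "x = S t y" by (auto simp: Y_def \<omega>)
      then show "x \<in> S t ` omega_limit S A" by blast
    qed
  qed
  have near: "\<exists>n. \<forall>y\<in>I n. infdist y (omega_limit S A) < e" if "e > 0" for e
  proof (rule ccontr)
    assume none: "\<not> ?thesis"
    define Y where "Y n = I n \<inter> {y. e \<le> infdist y (omega_limit S A)}" for n
    have "\<exists>y. \<forall>n. y \<in> Y n"
    proof (rule compact_nested_nonempty)
      fix n
      show "compact (Y n)"
        unfolding Y_def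
        by (intro compact_Int_closed I_compact closed_Collect_le continuous_intros)
      show "Y n \<noteq> {}" using none by (force simp: Y_def not_less)
    next
      show "decseq Y" using I_dec by (auto simp: decseq_def Y_def)
    qed
    then obtain y where y: "\<And>n. y \<in> Y n" by blast
    then have "y \<in> omega_limit S A" by (auto simp: Y_def \<omega>)
    then show False using y[of 0] \<open>e > 0\<close> by (simp add: Y_def)
  qed
  have "attracts S (omega_limit S A) D" if D: "D \<subseteq> X" "bounded D" for D
    unfolding attracts_def
  proof (rule order_tendstoI)
    fix a :: ennreal assume "0 < a"
    then obtain e where e: "e > 0" "ennreal e < a"
      by (metis dense ennreal_cases ennreal_less_zero_iff less_top top.extremum_strict order.strict_trans)
    obtain n where n: "\<And>y. y \<in> I n \<Longrightarrow> infdist y (omega_limit S A) < e"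
      using near[OF e(1)] by blast
    obtain T where T: "T \<ge> 0" "\<And>t. t \<ge> T \<Longrightarrow> S t ` D \<subseteq> A"
      using abs D by (auto simp: absorbing_def)
    show "\<forall>\<^sub>F t in at_top. (SUP x\<in>D. ennreal (infdist (S t x) (omega_limit S A))) < a"
    proof (rule eventually_at_top_linorderI)
      fix t assume t: "t \<ge> T + real n"
      have "infdist (S t x) (omega_limit S A) \<le> e" if x: "x \<in> D" for x
      proof -
        have "S t x = S (real n) (S (t - real n) x)"
          using semigroup[of "real n" "t - real n" x] t T(1) D(1) x by auto
        moreover have "S (t - real n) x \<in> A" using T(2)[of "t - real n"] t x by auto
        ultimately have "S t x \<in> I n" by (simp add: I_def)
        then show ?thesis using n by force
      qed
      then have "(SUP x\<in>D. ennreal (infdist (S t x) (omega_limit S A))) \<le> ennreal e"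
        by (intro SUP_least ennreal_leI)
      then show "(SUP x\<in>D. ennreal (infdist (S t x) (omega_limit S A))) < a"
        using e(2) by (rule le_less_trans)
    qed
  qed simp
  then show ?thesis
    unfolding compact_global_attractor_def
    using \<omega>_A A(1) \<omega>_ne \<omega>_compact \<omega>_inv by blast
qed

text \<open>
  The Lipschitz constant \<open>C * norm z\<close> grows with \<open>z\<close> but is independent of \<open>w\<close>. So it suffices
  that the energy estimate bounds one of the two solutions compared: in the semigroup law the other
  one is the time-shifted solution, in the continuity of \<open>S t\<close> at \<open>z\<close> it starts at an arbitrary
  point near \<open>z\<close>.
\<close>

lemma dissipative_semiflow_attractor:
  fixes G :: "'p::real_inner \<Rightarrow> 'p"
  assumes gen: "generates_semiflow G X S"
    and X: "0 \<in> X" "\<And>r. compact (X \<inter> cball 0 r)"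
    and diss: "\<And>z. z \<in> X \<Longrightarrow> G z \<bullet> z \<le> F * norm z - \<beta> * (norm z)\<^sup>2"
    and lip: "\<And>z w. z \<in> X \<Longrightarrow> w \<in> X \<Longrightarrow> (G z - G w) \<bullet> (z - w) \<le> C * norm z * (norm (z - w))\<^sup>2"
    and "C \<ge> 0" and "\<beta> > 0" and "F \<ge> 0" and R: "R > F / \<beta>"
  defines "A \<equiv> X \<inter> cball 0 R"
  shows "positively_invariant S A \<and> absorbing S X A \<and>
    compact_global_attractor S X (omega_limit S A)"
proof -
  have start: "S 0 z = z" and sol: "solves_on_halfline G X (\<lambda>t. S t z)" if "z \<in> X" for z
    using gen that by (auto simp: generates_semiflow_def)
  have S_X: "S t z \<in> X" if "z \<in> X" "t \<ge> 0" for t z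
    using sol that by (auto simp: solves_on_halfline_def)
  have R0: "0 \<le> F / \<beta>" "0 < R"
    using \<open>F \<ge> 0\<close> \<open>\<beta> > 0\<close> R by (simp, meson divide_nonneg_pos order.strict_trans1)
  have FR: "(F / \<beta>)\<^sup>2 < R\<^sup>2"
    using R0(1) R by (intro power_strict_mono) auto
  have decay: "(norm (S t z))\<^sup>2 - (F / \<beta>)\<^sup>2 \<le> exp (- \<beta> * t) * ((norm z)\<^sup>2 - (F / \<beta>)\<^sup>2)"
    if "z \<in> X" "t \<ge> 0" for t z
    using dissipative_energy_decay[OF sol[OF that(1)] diss \<open>\<beta> > 0\<close> that(2)] start that by simp
  have in_A: "S t z \<in> A" if "z \<in> X" "t \<ge> 0" "(norm (S t z))\<^sup>2 \<le> R\<^sup>2" for t z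
    using that S_X R0 by (auto simp: A_def abs_le_square_iff[symmetric])
  have le_exp: "exp (- \<beta> * t) * c \<le> max c 0" if "t \<ge> 0" for t c
  proof -
    have "exp (- \<beta> * t) \<le> 1" using that \<open>\<beta> > 0\<close> by simp
    then have "exp (- \<beta> * t) * max c 0 \<le> 1 * max c 0" by (intro mult_right_mono) auto
    moreover have "exp (- \<beta> * t) * c \<le> exp (- \<beta> * t) * max c 0" by (intro mult_left_mono) auto
    ultimately show ?thesis by linarith
  qed
  have inv: "positively_invariant S A"
    unfolding positively_invariant_def
  proof clarify
    fix t :: real and z assume t: "t \<ge> 0" and z: "z \<in> A"
    then have "(norm z)\<^sup>2 \<le> R\<^sup>2" using R0 by (auto simp: A_def intro: power_mono)
    then have "(norm (S t z))\<^sup>2 \<le> R\<^sup>2"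
      using decay[of z t] le_exp[OF t, of "(norm z)\<^sup>2 - (F / \<beta>)\<^sup>2"] FR t z by (auto simp: A_def)
    then show "S t z \<in> A" using in_A t z by (auto simp: A_def)
  qed
  have abs: "absorbing S X A"
    unfolding absorbing_def
  proof clarify
    fix D assume D: "D \<subseteq> X" "bounded D"
    then obtain M where M: "\<And>z. z \<in> D \<Longrightarrow> norm z \<le> M" by (auto simp: bounded_iff)
    have "((\<lambda>t. exp (- \<beta> * t) * M\<^sup>2) \<longlongrightarrow> 0) at_top"
      using \<open>\<beta> > 0\<close> by (intro tendsto_mult_left_zero filterlim_compose[OF exp_at_bot]
          filterlim_tendsto_neg_mult_at_bot[OF tendsto_const] filterlim_ident) auto
    then have "\<forall>\<^sub>F t in at_top. exp (- \<beta> * t) * M\<^sup>2 < R\<^sup>2 - (F / \<beta>)\<^sup>2"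
      by (rule order_tendstoD(2)) (use FR in simp)
    then obtain T where T: "\<And>t. t \<ge> T \<Longrightarrow> exp (- \<beta> * t) * M\<^sup>2 < R\<^sup>2 - (F / \<beta>)\<^sup>2"
      by (auto simp: eventually_at_top_linorder)
    have "S t z \<in> A" if t: "t \<ge> max T 0" and z: "z \<in> D" for t z
    proof -
      have "(norm z)\<^sup>2 - (F / \<beta>)\<^sup>2 \<le> M\<^sup>2"
        using power_mono[OF M[OF z] norm_ge_zero, of 2] zero_le_power2[of "F / \<beta>"] by linarith
      then have "exp (- \<beta> * t) * ((norm z)\<^sup>2 - (F / \<beta>)\<^sup>2) \<le> exp (- \<beta> * t) * M\<^sup>2"
        by (intro mult_left_mono) auto
      then have "(norm (S t z))\<^sup>2 \<le> R\<^sup>2"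
        using decay[OF subsetD[OF D(1) z], of t] T[of t] t by linarith
      then show ?thesis using in_A t z D by auto
    qed
    then show "\<exists>T\<ge>0. \<forall>t\<ge>T. S t ` D \<subseteq> A" by (intro exI[of _ "max T 0"]) auto
  qed
  have bdd: "norm (S t z) \<le> norm z + F / \<beta>" if "z \<in> X" "t \<ge> 0" for t z
  proof (rule power2_le_imp_le)
    have "(norm (S t z))\<^sup>2 \<le> (norm z)\<^sup>2 + (F / \<beta>)\<^sup>2"
      using decay[OF that] le_exp[OF that(2), of "(norm z)\<^sup>2 - (F / \<beta>)\<^sup>2"]
        zero_le_power2[of "norm z"] zero_le_power2[of "F / \<beta>"] by linarith
    also have "\<dots> \<le> (norm z + F / \<beta>)\<^sup>2" using mult_nonneg_nonneg[OF norm_ge_zero R0(1), of z]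
      by (simp add: power2_sum)
    finally show "(norm (S t z))\<^sup>2 \<le> (norm z + F / \<beta>)\<^sup>2" .
  qed (use R0 in simp)
  have stab: "norm (S t z - q t) \<le> exp (C * (norm z + F / \<beta>) * t) * norm (z - q 0)"
    if z: "z \<in> X" and q: "solves_on_halfline G X q" and t: "t \<ge> 0" for z q t
    using one_sided_lipschitz_stability[OF sol[OF z] q lip \<open>C \<ge> 0\<close> bdd[OF z] t] start[OF z]
    by simp
  have semigroup: "S (s + t) z = S s (S t z)" if "s \<ge> 0" "t \<ge> 0" "z \<in> X" for s t z
  proof -
    \<comment> \<open>The shifted orbit solves the autonomous equation, with initial value \<open>S t z\<close>.\<close>
    have q: "solves_on_halfline G X (\<lambda>s. S (s + t) z)"
      unfolding solves_on_halfline_def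
    proof (intro allI impI conjI)
      fix s :: real assume s: "s \<ge> 0"
      show "S (s + t) z \<in> X" using S_X s that by simp
      have 1: "((\<lambda>r. S r z) has_vector_derivative G (S (s + t) z)) (at (s + t) within {t..})"
        by (rule has_vector_derivative_within_subset[where S = "{0..}"])
          (use sol[OF that(3)] s that in \<open>auto simp: solves_on_halfline_def\<close>)
      have 2: "((\<lambda>r. r + t) has_vector_derivative 1) (at s within {0..})"
        by (auto intro!: derivative_eq_intros
            simp flip: has_real_derivative_iff_has_vector_derivative)
      have "(\<lambda>r. r + t) ` {0..} = {t..}" by (simp add: add.commute[of _ t])
      then have "((\<lambda>r. S r z) \<circ> (\<lambda>r. r + t) has_vector_derivative 1 *\<^sub>R G (S (s + t) z))
          (at s within {0..})"
        using vector_diff_chain_within[OF 2, of "\<lambda>r. S r z"] 1 by simp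
      then show "((\<lambda>s. S (s + t) z) has_vector_derivative G (S (s + t) z)) (at s within {0..})"
        by (simp add: o_def)
    qed
    show ?thesis using stab[OF S_X[OF that(3,2)] q that(1)] by simp
  qed
  have cont: "continuous_on X (S t)" if t: "t \<ge> 0" for t
    unfolding continuous_on_def
  proof
    fix z assume z: "z \<in> X"
    let ?L = "exp (C * (norm z + F / \<beta>) * t)"
    have "\<forall>\<^sub>F w in at z within X. dist (S t w) (S t z) \<le> ?L * norm (z - w)"
      using stab[OF z sol t] start
      by (auto simp: eventually_at_filter dist_norm norm_minus_commute)
    moreover have "((\<lambda>w. ?L * norm (z - w)) \<longlongrightarrow> ?L * norm (z - z)) (at z within X)"
      by (intro tendsto_intros)
    then have "((\<lambda>w. ?L * norm (z - w)) \<longlongrightarrow> 0) (at z within X)" by simp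
    moreover have "\<forall>\<^sub>F w in at z within X. 0 \<le> dist (S t w) (S t z)" by simp
    ultimately have "((\<lambda>w. dist (S t w) (S t z)) \<longlongrightarrow> 0) (at z within X)"
      by - (rule tendsto_sandwich[OF _ _ tendsto_const])
    then show "(S t \<longlongrightarrow> S t z) (at z within X)" by (rule tendsto_dist_iff[THEN iffD2])
  qed
  have "A \<subseteq> X" "compact A" "A \<noteq> {}" using X R0 by (auto simp: A_def)
  from compact_global_attractor_omega_limit[OF semigroup start cont this inv abs]
  show ?thesis using inv abs by simp
qed


section \<open>The coupled field\<close>

text \<open>
  Continuity at the origin bounds \<open>B\<close> on a small ball; rescaling both arguments into that ball
  turns this into the bound by a product of norms.
\<close>

lemma bilinear_on_subspace_bounded:
  fixes B :: "'c::real_normed_vector \<Rightarrow> 'c \<Rightarrow> 'c"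
  assumes V: "subspace V" and B: "bilinear_on_subspace V B"
    and cont: "continuous_on (V \<times> V) (\<lambda>(a, b). B a b)"
  shows "\<exists>C\<ge>0. \<forall>a\<in>V. \<forall>b\<in>V. norm (B a b) \<le> C * norm a * norm b"
proof -
  have scale: "B (r *\<^sub>R a) (s *\<^sub>R b) = (r * s) *\<^sub>R B a b" if "a \<in> V" "b \<in> V" for r s a b
    using B V that by (simp add: bilinear_on_subspace_def subspace_scale)
  have "0 \<in> V" using V by (rule subspace_0)
  then have B0: "B a 0 = 0" "B 0 a = 0" if "a \<in> V" for a
    using scale[OF that \<open>0 \<in> V\<close>, of 1 0] scale[OF \<open>0 \<in> V\<close> that, of 0 1] by simp_all
  obtain \<delta> where \<delta>: "\<delta> > 0" and small: "\<And>x. x \<in> V \<times> V \<Longrightarrow> dist x (0, 0) < \<delta> \<Longrightarrow>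
      dist (case x of (a, b) \<Rightarrow> B a b) (case (0, 0) of (a, b) \<Rightarrow> B a b) < 1"
    using cont \<open>0 \<in> V\<close> unfolding continuous_on_iff by (metis SigmaI zero_less_one)
  define \<epsilon> where "\<epsilon> = \<delta> / 3"
  have \<epsilon>: "\<epsilon> > 0" using \<delta> by (simp add: \<epsilon>_def)
  have "norm (B a b) \<le> 1 / \<epsilon>\<^sup>2 * norm a * norm b" if "a \<in> V" "b \<in> V" for a b
  proof (cases "a = 0 \<or> b = 0")
    case True
    then show ?thesis using B0 that by auto
  next
    case False
    \<comment> \<open>Norm \<open>\<delta> / 3\<close> for each component keeps the pair strictly within distance \<open>\<delta>\<close> of the origin.\<close>
    define a' b' where "a' = (\<epsilon> / norm a) *\<^sub>R a" and "b' = (\<epsilon> / norm b) *\<^sub>R b"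
    have n: "norm a' = \<epsilon>" "norm b' = \<epsilon>" using False \<epsilon> by (simp_all add: a'_def b'_def)
    have "norm (a', b') \<le> \<epsilon> + \<epsilon>" using norm_Pair_le[of a' b'] n by simp
    then have "dist (a', b') (0, 0) < \<delta>"
      using \<delta> by (simp add: dist_norm \<epsilon>_def flip: zero_prod_def)
    moreover have "(a', b') \<in> V \<times> V" using V that by (simp add: a'_def b'_def subspace_scale)
    ultimately have "norm (B a' b') < 1" using small B0[OF \<open>0 \<in> V\<close>] by fastforce
    also have "B a' b' = (\<epsilon> / norm a * (\<epsilon> / norm b)) *\<^sub>R B a b"
      unfolding a'_def b'_def by (rule scale[OF that])
    finally show ?thesis using \<epsilon> False by (simp add: field_simps power2_eq_square)
  qed
  then show ?thesis by (intro exI[of _ "1 / \<epsilon>\<^sup>2"]) auto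
qed

text \<open>
  In the energy balance \<open>B u u \<bullet> u\<close> and \<open>B u h \<bullet> h\<close> vanish, and the work \<open>- B h h \<bullet> u\<close> of the
  \<open>h\<close>-field on \<open>u\<close> cancels \<open>- B h u \<bullet> h\<close>.
\<close>

lemma mhd_field_dissipative:
  fixes d0 :: "'c0::real_inner \<Rightarrow> 'c1::real_inner" and d1 :: "'c1 \<Rightarrow> 'c2::real_inner"
    and V :: "'c1 set" and f g :: 'c1
  assumes V: "V = div_free d0"
    and anti: "\<And>a b c. a \<in> V \<Longrightarrow> b \<in> V \<Longrightarrow> c \<in> V \<Longrightarrow> B a b \<bullet> c = - (B a c \<bullet> b)"
    and coercive: "\<And>v. v \<in> V \<Longrightarrow> \<mu> * (norm v)\<^sup>2 \<le> hodge_laplacian1 d0 d1 v \<bullet> v"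
    and pos: "\<nu> > 0" "\<eta> > 0" "\<mu> > 0"
    and z: "z \<in> V \<times> V"
  defines "F \<equiv> sqrt ((norm (orth_projection V f))\<^sup>2 + (norm (orth_projection V g))\<^sup>2)"
  shows "mhd_field d0 d1 B \<nu> \<eta> f g z \<bullet> z \<le> F * norm z - min \<nu> \<eta> * \<mu> * (norm z)\<^sup>2"
proof -
  obtain u h where zuh: "z = (u, h)" and u: "u \<in> V" and h: "h \<in> V" using z by auto
  let ?L = "hodge_laplacian1 d0 d1" and ?Pf = "orth_projection V f" and ?Pg = "orth_projection V g"
  have B: "B u u \<bullet> u = 0" "B u h \<bullet> h = 0" "B h h \<bullet> u = - (B h u \<bullet> h)"
    using anti[of u u u] anti[of u h h] anti[of h h u] u h by simp_all
  have visc: "min \<nu> \<eta> * \<mu> * (norm v)\<^sup>2 \<le> \<kappa> * (?L v \<bullet> v)"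
    if "v \<in> V" "min \<nu> \<eta> \<le> \<kappa>" for v \<kappa>
  proof -
    have "0 \<le> \<mu> * (norm v)\<^sup>2" using pos by simp
    then have "min \<nu> \<eta> * (\<mu> * (norm v)\<^sup>2) \<le> \<kappa> * (?L v \<bullet> v)"
      using coercive[OF that(1)] that(2) pos by (intro mult_mono) auto
    then show ?thesis by (simp add: mult.assoc)
  qed
  have "(?Pf, ?Pg) \<bullet> z \<le> norm (?Pf, ?Pg) * norm z" by (rule norm_cauchy_schwarz)
  then have force: "?Pf \<bullet> u + ?Pg \<bullet> h \<le> F * norm z" by (simp add: zuh F_def norm_Pair)
  have nz: "(norm z)\<^sup>2 = (norm u)\<^sup>2 + (norm h)\<^sup>2" by (simp add: zuh norm_Pair)
  have "mhd_field d0 d1 B \<nu> \<eta> f g z \<bullet> z =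
      ?Pf \<bullet> u + ?Pg \<bullet> h - \<nu> * (?L u \<bullet> u) - \<eta> * (?L h \<bullet> h)"
    by (simp add: zuh mhd_field_def B inner_add_left inner_diff_left flip: V)
  also have "\<dots> \<le> F * norm z - min \<nu> \<eta> * \<mu> * (norm z)\<^sup>2"
    using visc[OF u, of \<nu>] visc[OF h, of \<eta>] force unfolding nz by (simp add: distrib_left)
  finally show ?thesis .
qed

text \<open>
  For the difference \<open>(a, b)\<close> of two states each quadratic term is split so that the first state
  \<open>z\<close> is the one that survives: the terms that contain the second state cancel by antisymmetry as
  in the energy balance, and the dissipation has the favourable sign. Boundedness of the Laplacian
  does not enter.
\<close>

lemma mhd_field_one_sided_lipschitz:
  fixes d0 :: "'c0::real_inner \<Rightarrow> 'c1::real_inner" and d1 :: "'c1 \<Rightarrow> 'c2::real_inner"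
    and V :: "'c1 set"
  assumes V: "V = div_free d0" "subspace V"
    and lap: "linear (hodge_laplacian1 d0 d1)"
    and bil: "bilinear_on_subspace V B"
    and anti: "\<And>a b c. a \<in> V \<Longrightarrow> b \<in> V \<Longrightarrow> c \<in> V \<Longrightarrow> B a b \<bullet> c = - (B a c \<bullet> b)"
    and bd: "\<And>a b. a \<in> V \<Longrightarrow> b \<in> V \<Longrightarrow> norm (B a b) \<le> C * norm a * norm b"
    and nonneg: "\<And>v. v \<in> V \<Longrightarrow> 0 \<le> hodge_laplacian1 d0 d1 v \<bullet> v"
    and pos: "\<nu> > 0" "\<eta> > 0" "C \<ge> 0"
    and z: "z \<in> V \<times> V" and w: "w \<in> V \<times> V"
  shows "(mhd_field d0 d1 B \<nu> \<eta> f g z - mhd_field d0 d1 B \<nu> \<eta> f g w) \<bullet> (z - w)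
    \<le> 2 * C * norm z * (norm (z - w))\<^sup>2"
proof -
  obtain u h where zuh: "z = (u, h)" and u: "u \<in> V" and h: "h \<in> V" using z by auto
  obtain u' h' where wuh: "w = (u', h')" and u': "u' \<in> V" and h': "h' \<in> V" using w by auto
  define a b where "a = u - u'" and "b = h - h'"
  have a: "a \<in> V" and b: "b \<in> V"
    using V(2) u u' h h' by (simp_all add: a_def b_def subspace_diff)
  let ?L = "hodge_laplacian1 d0 d1"
  have split: "B p q - B p' q' = B (p - p') q + B p' (q - q')"
    if "p \<in> V" "q \<in> V" "p' \<in> V" "q' \<in> V" for p q p' q'
  proof -
    have "p - p' \<in> V" "q - q' \<in> V" using that V(2) by (simp_all add: subspace_diff)
    then have "B (p - p' + p') q = B (p - p') q + B p' q"
      "B p' (q - q' + q') = B p' (q - q') + B p' q'"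
      using bil that unfolding bilinear_on_subspace_def by blast+
    then show ?thesis by simp
  qed
  have s: "B u u - B u' u' = B a u + B u' a" "B h h - B h' h' = B b h + B h' b"
    "B u h - B u' h' = B a h + B u' b" "B h u - B h' u' = B b u + B h' a"
    using split u u' h h' by (simp_all add: a_def b_def)
  have fst: "fst (mhd_field d0 d1 B \<nu> \<eta> f g z - mhd_field d0 d1 B \<nu> \<eta> f g w) =
      - \<nu> *\<^sub>R ?L a + (B a u + B u' a) - (B b h + B h' b)"
    by (simp add: zuh wuh mhd_field_def a_def linear_diff[OF lap] scaleR_diff_right
        flip: s[unfolded a_def])
  have snd: "snd (mhd_field d0 d1 B \<nu> \<eta> f g z - mhd_field d0 d1 B \<nu> \<eta> f g w) =
      - \<eta> *\<^sub>R ?L b + (B a h + B u' b) - (B b u + B h' a)"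
    by (simp add: zuh wuh mhd_field_def b_def linear_diff[OF lap] scaleR_diff_right
        flip: s[unfolded b_def])
  have cancel: "B u' a \<bullet> a = 0" "B u' b \<bullet> b = 0" "B h' b \<bullet> a = - (B h' a \<bullet> b)"
    using anti[of u' a a] anti[of u' b b] anti[of h' b a] u' h' a b by simp_all
  have "(mhd_field d0 d1 B \<nu> \<eta> f g z - mhd_field d0 d1 B \<nu> \<eta> f g w) \<bullet> (z - w) =
      (- \<nu> *\<^sub>R ?L a + (B a u + B u' a) - (B b h + B h' b)) \<bullet> a +
      (- \<eta> *\<^sub>R ?L b + (B a h + B u' b) - (B b u + B h' a)) \<bullet> b"
    unfolding inner_prod_def fst snd by (simp add: zuh wuh a_def b_def)
  also have "\<dots> = B a u \<bullet> a - B b h \<bullet> a + B a h \<bullet> b - B b u \<bullet> b - \<nu> * (?L a \<bullet> a) - \<eta> * (?L b \<bullet> b)"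
    by (simp add: inner_add_left inner_diff_left cancel)
  also have "\<dots> \<le> \<bar>B a u \<bullet> a\<bar> + \<bar>B b h \<bullet> a\<bar> + \<bar>B a h \<bullet> b\<bar> + \<bar>B b u \<bullet> b\<bar>"
    using mult_nonneg_nonneg[OF less_imp_le[OF pos(1)] nonneg[OF a]]
      mult_nonneg_nonneg[OF less_imp_le[OF pos(2)] nonneg[OF b]] by linarith
  also have "\<dots> \<le> C * norm z * (norm a * norm a) + C * norm z * (norm b * norm a) +
      C * norm z * (norm a * norm b) + C * norm z * (norm b * norm b)"
  proof -
    have "\<bar>B x y \<bullet> c\<bar> \<le> C * norm z * (norm x * norm c)"
      if "x \<in> V" "y \<in> V" "norm y \<le> norm z" for x y c
    proof -
      have "\<bar>B x y \<bullet> c\<bar> \<le> norm (B x y) * norm c" by (rule Cauchy_Schwarz_ineq2)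
      also have "\<dots> \<le> C * norm x * norm y * norm c"
        using bd[OF that(1,2)] by (intro mult_right_mono) auto
      also have "\<dots> \<le> C * norm x * norm z * norm c"
        using that(3) pos(3) by (intro mult_right_mono mult_left_mono) auto
      finally show ?thesis by (simp add: mult_ac)
    qed
    moreover have "norm u \<le> norm z" "norm h \<le> norm z"
      using norm_fst_le[of u h] norm_snd_le[of h u] by (simp_all add: zuh)
    ultimately show ?thesis using a b u h by (intro add_mono) auto
  qed
  also have "\<dots> = C * norm z * (norm a + norm b)\<^sup>2" by (simp add: power2_eq_square algebra_simps)
  also have "\<dots> \<le> C * norm z * (2 * ((norm a)\<^sup>2 + (norm b)\<^sup>2))"
  proof (intro mult_left_mono)
    show "(norm a + norm b)\<^sup>2 \<le> 2 * ((norm a)\<^sup>2 + (norm b)\<^sup>2)"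
      using zero_le_power2[of "norm a - norm b"] by (simp add: power2_eq_square algebra_simps)
  qed (use pos in simp)
  also have "\<dots> = 2 * C * norm z * (norm (z - w))\<^sup>2"
    by (simp add: zuh wuh norm_Pair a_def b_def)
  finally show ?thesis .
qed

lemma phase_ball_eq:
  assumes "R \<ge> 0"
  shows "phase_ball V R = (V \<times> V) \<inter> cball 0 R"
  using assms by (auto simp: phase_ball_def norm_Pair intro: real_le_lsqrt dest: sqrt_le_D)

theorem theorem3:
  fixes K :: "('v, 'e, 'f) complex2"
    and ev0 :: "'c0::real_inner \<Rightarrow> 'v \<Rightarrow> real"
    and ev1 :: "'c1::real_inner \<Rightarrow> 'e \<Rightarrow> real"
    and ev2 :: "'c2::real_inner \<Rightarrow> 'f \<Rightarrow> real"
    and d0 :: "'c0 \<Rightarrow> 'c1" and d1 :: "'c1 \<Rightarrow> 'c2"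
    and V :: "'c1 set" and B :: "'c1 \<Rightarrow> 'c1 \<Rightarrow> 'c1"
    and \<nu> \<eta> \<mu> \<beta> F R :: real
    and f g :: 'c1
    and S :: "real \<Rightarrow> 'c1 \<times> 'c1 \<Rightarrow> 'c1 \<times> 'c1"
  assumes "finite_cell_complex K"
    and "cochain_space (vertices K) ev0"
    and "cochain_space (edges K) ev1"
    and "cochain_space (faces K) ev2"
    and "d0 = coboundary0 K ev0 ev1"
    and "d1 = coboundary1 K ev1 ev2"
    and "V = div_free d0"
    and "\<nu> > 0" and "\<eta> > 0"
    and "bilinear_on_subspace V B"
    and "continuous_on (V \<times> V) (\<lambda>(a, b). B a b)"
    and "\<forall>a\<in>V. \<forall>b\<in>V. \<forall>c\<in>V. B a b \<bullet> c = - (B a c \<bullet> b)"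
    and "generates_semiflow (mhd_field d0 d1 B \<nu> \<eta> f g) (V \<times> V) S"
    and "harmonic1 d0 d1 = {0}"
    and "\<mu> > 0"
    and "\<forall>v\<in>V. hodge_laplacian1 d0 d1 v \<bullet> v \<ge> \<mu> * (norm v)\<^sup>2"
    and "\<beta> = min \<nu> \<eta> * \<mu>"
    and "F = sqrt ((norm (orth_projection V f))\<^sup>2 + (norm (orth_projection V g))\<^sup>2)"
    and "R > F / \<beta>"
  shows "positively_invariant S (phase_ball V R) \<and>
    absorbing S (V \<times> V) (phase_ball V R) \<and>
    compact_global_attractor S (V \<times> V) (omega_limit S (phase_ball V R))"
proof -
  note K = assms(1) and C0 = assms(2) and C1 = assms(3) and C2 = assms(4)
  have fin: "finite (vertices K)" "finite (edges K)"
    using K by (simp_all add: finite_cell_complex_def)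
  obtain A0 where A0: "finite A0" "span A0 = (UNIV :: 'c0 set)"
    using cochain_space_finite_span[OF C0 fin(1)] by blast
  obtain A1 where A1: "finite A1" "span A1 = (UNIV :: 'c1 set)"
    using cochain_space_finite_span[OF C1 fin(2)] by blast
  have d0: "linear d0" and d1: "linear d1"
    unfolding \<open>d0 = _\<close> \<open>d1 = _\<close>
    by (rule linear_coboundary0[OF C0 C1], rule linear_coboundary1[OF C1 C2])
  note d0' = linear_adjoint_finite_span[OF d0 A0] and d1' = linear_adjoint_finite_span[OF d1 A1]
  have lap: "linear (hodge_laplacian1 d0 d1)"
    by (rule linear_hodge_laplacian1[OF d0 d0' d1 d1'])
  have "subspace V"
    unfolding \<open>V = _\<close> div_free_def by (rule linear_subspace_kernel[OF d0'])
  have "closed V"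
    unfolding \<open>V = _\<close> by (rule closed_div_free[OF adjoint_inner_finite_span[OF d0 A0]])
  have compact: "compact ((V \<times> V) \<inter> cball 0 r)" for r
  proof -
    have "compact ((cball 0 r \<inter> V) \<times> (cball 0 r \<inter> V))"
      using compact_cball_finite_span[OF A1] \<open>closed V\<close>
      by (intro compact_Times compact_Int_closed) auto
    then have "compact ((cball 0 r \<inter> V) \<times> (cball 0 r \<inter> V) \<inter> cball 0 r)"
      by (rule compact_Int_closed) simp
    moreover have "(cball 0 r \<inter> V) \<times> (cball 0 r \<inter> V) \<inter> cball 0 r = (V \<times> V) \<inter> cball 0 r"
      by (auto intro: order_trans[OF norm_fst_le] order_trans[OF norm_snd_le])
    ultimately show ?thesis by simp
  qed
  obtain C where C: "C \<ge> 0" "\<And>a b. a \<in> V \<Longrightarrow> b \<in> V \<Longrightarrow> norm (B a b) \<le> C * norm a * norm b"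
    using bilinear_on_subspace_bounded[OF \<open>subspace V\<close> assms(10,11)] by blast
  have nonneg: "0 \<le> hodge_laplacian1 d0 d1 v \<bullet> v" if "v \<in> V" for v
    using that assms(16) \<open>\<mu> > 0\<close> by (meson less_imp_le mult_nonneg_nonneg order_trans zero_le_power2)
  have anti: "B a b \<bullet> c = - (B a c \<bullet> b)" if "a \<in> V" "b \<in> V" "c \<in> V" for a b c
    using assms(12) that by blast
  have diss: "mhd_field d0 d1 B \<nu> \<eta> f g z \<bullet> z \<le> F * norm z - \<beta> * (norm z)\<^sup>2"
    if "z \<in> V \<times> V" for z
    unfolding \<open>F = _\<close> \<open>\<beta> = _\<close>
    using assms(16) by (intro mhd_field_dissipative[OF assms(7) anti _ assms(8,9,15) that]) auto
  have lip: "(mhd_field d0 d1 B \<nu> \<eta> f g z - mhd_field d0 d1 B \<nu> \<eta> f g w) \<bullet> (z - w)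
      \<le> 2 * C * norm z * (norm (z - w))\<^sup>2" if "z \<in> V \<times> V" "w \<in> V \<times> V" for z w
    by (rule mhd_field_one_sided_lipschitz[OF assms(7) \<open>subspace V\<close> lap assms(10) anti C(2) nonneg
          assms(8,9) C(1) that])
  have pos: "\<beta> > 0" "F \<ge> 0"
    using assms(8,9,15) by (simp_all add: \<open>F = _\<close> \<open>\<beta> = _\<close>)
  then have "R \<ge> 0" using \<open>R > F / \<beta>\<close> by (meson divide_nonneg_pos less_imp_le order_trans)
  have "0 \<in> V \<times> V" using subspace_0[OF \<open>subspace V\<close>] by (simp add: zero_prod_def)
  then show ?thesis
    unfolding phase_ball_eq[OF \<open>R \<ge> 0\<close>]
    using C(1) by (intro dissipative_semiflow_attractor[OF assms(13) _ compact diss lip _ pos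
          \<open>R > F / \<beta>\<close>]) auto
qed

end
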